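(* If $G$ is a connected graph, then $p(G)\ge \lceil \lg n(G)\rceil$.
   Context: All graphs are finite and simple; $n(G)=|V(G)|$ and $\lg$ is the logarithm to base 2. An edge-coloring of $G$ is any assignment of colors to its edges. A parity walk (in an edge-coloring) is a walk along which every color is used an even number of times. A parity path is a parity walk that is a path with at least one edge. A parity edge-coloring is an edge-coloring having no parity path. $p(G)$ is the minimum number of colors in a parity edge-coloring of $G$. *)

theory Defs
  imports Complex_Main "Graph_Theory.Graph_Theory"
begin

text \<open>
  A finite simple graph is a \<^locale>\<open>pair_graph\<close>: each undirected edge \<open>uv\<close> is present
  as the two arcs \<open>(u,v)\<close> and \<open>(v,u)\<close>. Edge-colorings live on the unordered pairs \<open>{u,v}\<close>,
  so both arcs of an edge have the same color.
\<close>

definition edges :: "'a pair_pre_digraph \<Rightarrow> 'a set set" where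
  "edges G = (\<lambda>(u, v). {u, v}) ` parcs G"

definition walk_edges :: "'a vwalk \<Rightarrow> 'a set list" where
  "walk_edges w = map (\<lambda>(u, v). {u, v}) (vwalk_arcs w)"

definition parity_walk :: "'a pair_pre_digraph \<Rightarrow> ('a set \<Rightarrow> 'c) \<Rightarrow> 'a vwalk \<Rightarrow> bool" where
  "parity_walk G c w \<longleftrightarrow>
     vwalk w (with_proj G) \<and> (\<forall>a. even (count_list (map c (walk_edges w)) a))"

definition parity_path :: "'a pair_pre_digraph \<Rightarrow> ('a set \<Rightarrow> 'c) \<Rightarrow> 'a vwalk \<Rightarrow> bool" where
  "parity_path G c w \<longleftrightarrow>
     parity_walk G c w \<and> vpath w (with_proj G) \<and> vwalk_length w \<ge> 1"

definition parity_edge_coloring :: "'a pair_pre_digraph \<Rightarrow> ('a set \<Rightarrow> 'c) \<Rightarrow> bool" where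
  "parity_edge_coloring G c \<longleftrightarrow> (\<nexists>w. parity_path G c w)"

text \<open>
  A finite graph has finitely many edges, so natural numbers suffice as colors. Only the colors
  of actual edges are counted; values of the coloring on other sets are irrelevant.
\<close>

definition parity_number :: "'a pair_pre_digraph \<Rightarrow> nat" where
  "parity_number G = (LEAST k. \<exists>c :: 'a set \<Rightarrow> nat. parity_edge_coloring G c \<and> card (c ` edges G) = k)"

text \<open>The minimum in the definition of \<^const>\<open>parity_number\<close> ranges over a nonempty set of colorings.\<close>

lemma walk_edges_subset:
  assumes "vwalk w (with_proj G)"
  shows "set (walk_edges w) \<subseteq> edges G"
  using assms by (auto simp: vwalk_def walk_edges_def edges_def)

lemma set_vwalk_arcs_subset:
  "(u, v) \<in> set (vwalk_arcs w) \<Longrightarrow> u \<in> set w \<and> v \<in> set w"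
  by (induction w rule: vwalk_arcs.induct) auto

lemma inj_on_parity_edge_coloring:
  assumes "inj_on c (edges G)"
  shows "parity_edge_coloring G c"
  unfolding parity_edge_coloring_def
proof
  assume "\<exists>w. parity_path G c w"
  then obtain w where w: "parity_path G c w" by blast
  then have walk: "vwalk w (with_proj G)" and dist: "distinct w" and len: "length w \<ge> 2"
    and ev: "\<And>a. even (count_list (map c (walk_edges w)) a)"
    by (auto simp: parity_path_def parity_walk_def vpath_def)
  obtain x y ys where wxy: "w = x # y # ys"
    using len by (metis One_nat_def Suc_le_length_iff numeral_2_eq_2)
  have w_edges: "walk_edges w = {x, y} # walk_edges (y # ys)"
    by (simp add: wxy walk_edges_def)
  have "{x, y} \<notin> set (walk_edges (y # ys))"
    using dist set_vwalk_arcs_subset[of _ _ "y # ys"]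
    by (fastforce simp: wxy walk_edges_def doubleton_eq_iff)
  moreover have "set (walk_edges w) \<subseteq> edges G"
    using walk by (rule walk_edges_subset)
  ultimately have "c {x, y} \<notin> c ` set (walk_edges (y # ys))"
    using assms by (auto simp: w_edges inj_on_def)
  then have "count_list (map c (walk_edges w)) (c {x, y}) = 1"
    by (simp add: w_edges)
  then show False
    using ev[of "c {x, y}"] by simp
qed

lemma ex_parity_edge_coloring:
  assumes "pair_graph G"
  shows "\<exists>c :: 'a set \<Rightarrow> nat. parity_edge_coloring (G :: 'a pair_pre_digraph) c"
proof -
  interpret pair_graph G by fact
  have "finite (edges G)"
    by (simp add: edges_def)
  then obtain c :: "'a set \<Rightarrow> nat" where "inj_on c (edges G)"
    using finite_imp_inj_to_nat_seg by blast
  then show ?thesis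
    using inj_on_parity_edge_coloring by blast
qed

end

theory Submission
  imports Defs
begin

text \<open>
  Grow a tree in \<open>G\<close> one leaf at a time, labelling each vertex by the set of colors used an odd
  number of times on its path from the root. The colors used oddly often on the tree path between
  two vertices form the symmetric difference of their labels, so in a parity edge-coloring the
  labels of a spanning tree are pairwise distinct subsets of the set of colors.
\<close>

definition labelled_path ::
  "'a pair_pre_digraph \<Rightarrow> ('a set \<Rightarrow> 'c) \<Rightarrow> ('a \<Rightarrow> 'c set) \<Rightarrow> 'a \<Rightarrow> 'a \<Rightarrow> 'a vwalk \<Rightarrow> bool" where
  "labelled_path G c f u v w \<longleftrightarrow> vpath w (with_proj G) \<and> hd w = u \<and> last w = v \<and>
     (\<forall>a. odd (count_list (map c (walk_edges w)) a) \<longleftrightarrow> (a \<in> f u) \<noteq> (a \<in> f v))"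

text \<open>The tree itself is not stored. What is kept is the existence of a path between any two
  vertices of \<open>S\<close>, with its odd colors given by the symmetric difference of the end
  labels. Demanding \<open>set w \<subseteq> S\<close> lets such a path be prolonged by a vertex
  outside \<open>S\<close> without repeating a vertex.\<close>

definition tree_labelling ::
  "'a pair_pre_digraph \<Rightarrow> ('a set \<Rightarrow> 'c) \<Rightarrow> 'a set \<Rightarrow> ('a \<Rightarrow> 'c set) \<Rightarrow> bool" where
  "tree_labelling G c S f \<longleftrightarrow> (\<forall>u\<in>S. f u \<subseteq> c ` edges G) \<and>
     (\<forall>u\<in>S. \<forall>v\<in>S. \<exists>w. labelled_path G c f u v w \<and> set w \<subseteq> S)"

lemma walk_edges_Cons:
  "w \<noteq> [] \<Longrightarrow> walk_edges (x # w) = {x, hd w} # walk_edges w"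
  by (cases w) (simp_all add: walk_edges_def)

lemma walk_edges_snoc:
  "w \<noteq> [] \<Longrightarrow> walk_edges (w @ [x]) = walk_edges w @ [{last w, x}]"
proof (induction w)
  case (Cons y w)
  then show ?case
    by (cases "w = []") (simp_all add: walk_edges_Cons, simp add: walk_edges_def)
qed simp

lemma vwalk_arcs_snoc:
  "w \<noteq> [] \<Longrightarrow> vwalk_arcs (w @ [x]) = vwalk_arcs w @ [(last w, x)]"
  by (induction w rule: vwalk_arcs.induct) auto

lemma (in pair_graph) tree_labelling_singleton:
  assumes "r \<in> pverts G"
  shows "tree_labelling G c {r} (\<lambda>_. {})"
  using assms unfolding tree_labelling_def labelled_path_def vpath_def vwalk_def
  by (auto intro!: exI[of _ "[r]"] simp: walk_edges_def)

text \<open>The new leaf \<open>x\<close> inherits the label of its neighbor \<open>u\<close> with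
  membership of the color of \<open>ux\<close> toggled. A path between \<open>x\<close> and a vertex
  of \<open>S\<close> is a path for \<open>u\<close> prolonged by that edge, which flips the parity
  of exactly this one color.\<close>

lemma (in pair_graph) tree_labelling_insert:
  assumes lab: "tree_labelling G c S f"
    and u: "u \<in> S" and x: "x \<notin> S" and arc: "(u, x) \<in> parcs G"
  shows "tree_labelling G c (insert x S)
    (f(x := {a. (a \<in> f u) \<noteq> (a = c {u, x})}))"
    (is "tree_labelling G c _ ?f")
  unfolding tree_labelling_def
proof (intro conjI ballI)
  have edge: "{u, x} \<in> edges G"
    using arc by (force simp: edges_def)
  show "?f v \<subseteq> c ` edges G" if "v \<in> insert x S" for v
    using that lab u edge by (auto simp: tree_labelling_def)
next
  have xV: "x \<in> pverts G" and xu: "(x, u) \<in> parcs G"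
    using arc by (auto simp: arcs_symmetric in_arcsD2)
  have f_x: "a \<in> ?f x \<longleftrightarrow> (a \<in> f u) \<noteq> (a = c {u, x})" for a
    by simp
  have f_S: "?f y = f y" if "y \<in> S" for y
    using that x by auto
  fix y z assume yz: "y \<in> insert x S" "z \<in> insert x S"
  consider "y = x" "z = x" | "y = x" "z \<in> S" | "y \<in> S" "z = x" | "y \<in> S" "z \<in> S"
    using yz by blast
  then show "\<exists>w. labelled_path G c ?f y z w \<and> set w \<subseteq> insert x S"
  proof cases
    case 1
    then have "labelled_path G c ?f y z [x]"
      using xV by (simp add: labelled_path_def vpath_def vwalk_def walk_edges_def)
    then show ?thesis
      by (intro exI[of _ "[x]"]) simp
  next
    case 2
    then obtain w where w: "labelled_path G c f u z w" "set w \<subseteq> S"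
      using lab u unfolding tree_labelling_def by blast
    then have ne: "w \<noteq> []"
      by (auto simp: labelled_path_def vpath_def vwalk_def)
    have "vpath (x # w) (with_proj G)"
      using w x xV xu ne by (cases w) (auto simp: labelled_path_def vpath_def vwalk_def)
    \<comment> \<open>The added first edge appears as \<open>{x, u}\<close>, while the label uses
      \<open>{u, x}\<close>; \<open>insert_commute\<close> identifies the two.\<close>
    moreover have "odd (count_list (map c (walk_edges (x # w))) a) \<longleftrightarrow> (a \<in> ?f x) \<noteq> (a \<in> ?f z)" for a
      using w(1) ne unfolding f_S[OF 2(2)] f_x
      by (auto simp: labelled_path_def walk_edges_Cons insert_commute)
    ultimately have "labelled_path G c ?f y z (x # w)"
      using w(1) ne unfolding labelled_path_def 2(1) by simp
    then show ?thesis
      using w(2) by (intro exI[of _ "x # w"]) auto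
  next
    case 3
    then obtain w where w: "labelled_path G c f y u w" "set w \<subseteq> S"
      using lab u unfolding tree_labelling_def by blast
    then have ne: "w \<noteq> []"
      by (auto simp: labelled_path_def vpath_def vwalk_def)
    have "vpath (w @ [x]) (with_proj G)"
      using w x xV arc ne by (auto simp: labelled_path_def vpath_def vwalk_def vwalk_arcs_snoc)
    moreover have "odd (count_list (map c (walk_edges (w @ [x]))) a) \<longleftrightarrow> (a \<in> ?f y) \<noteq> (a \<in> ?f x)" for a
      using w(1) ne unfolding f_S[OF 3(1)] f_x
      by (auto simp: labelled_path_def walk_edges_snoc)
    ultimately have "labelled_path G c ?f y z (w @ [x])"
      using w(1) ne unfolding labelled_path_def 3(2) by simp
    then show ?thesis
      using w(2) by (intro exI[of _ "w @ [x]"]) auto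
  next
    case 4
    then obtain w where "labelled_path G c f y z w" "set w \<subseteq> S"
      using lab unfolding tree_labelling_def by blast
    moreover have "labelled_path G c ?f y z = labelled_path G c f y z"
      unfolding labelled_path_def f_S[OF 4(1)] f_S[OF 4(2)] ..
    ultimately show ?thesis
      by auto
  qed
qed

text \<open>Equal labels have empty symmetric difference, so the path joining two such vertices
  would use every color evenly.\<close>

lemma tree_labelling_inj_on:
  assumes "parity_edge_coloring G c" "tree_labelling G c S f"
  shows "inj_on f S"
proof (rule inj_onI, rule ccontr)
  fix u v assume uv: "u \<in> S" "v \<in> S" "f u = f v" "u \<noteq> v"
  then obtain w where "labelled_path G c f u v w"
    using assms(2) unfolding tree_labelling_def by blast
  then have w: "vpath w (with_proj G)" "hd w = u" "last w = v"
    "\<And>a. even (count_list (map c (walk_edges w)) a)"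
    using uv(3) by (auto simp: labelled_path_def)
  \<comment> \<open>A one-vertex path would have equal ends, contrary to
    \<open>u \<noteq> v\<close>.\<close>
  have "vwalk_length w \<ge> 1"
    using w uv by (cases w rule: vwalk_arcs.cases) (auto simp: vpath_def)
  then have "parity_path G c w"
    using w by (simp add: parity_path_def parity_walk_def vpath_def)
  then show False
    using assms(1) by (auto simp: parity_edge_coloring_def)
qed

text \<open>Otherwise \<open>S\<close> would be closed under reachability. Since arcs come in
  symmetric pairs, connectedness yields directed reachability, so \<open>S\<close> would contain
  every vertex.\<close>

lemma (in pair_graph) crossing_arc:
  assumes conn: "Digraph_Component.connected (with_proj G)"
    and "S \<subset> pverts G" "S \<noteq> {}"
  shows "\<exists>u x. u \<in> S \<and> x \<notin> S \<and> (u, x) \<in> parcs G"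
proof (rule ccontr)
  assume "\<not> ?thesis"
  then have closed: "x \<in> S" if "u \<in> S" "(u, x) \<in> parcs G" for u x
    using that by blast
  obtain r v where rv: "r \<in> S" "v \<in> pverts G" "v \<notin> S"
    using assms by blast
  have "strongly_connected (with_proj G)"
    using symmetric_connected_imp_strongly_connected[OF sym_arcs conn] .
  then have "r \<rightarrow>\<^sup>*\<^bsub>with_proj G\<^esub> v"
    using rv assms(2) by (auto simp: strongly_connected_def)
  then have "v \<in> S"
    using rv(1) by (induction rule: reachable_induct) (auto intro: closed)
  then show False
    using rv by blast
qed

lemma (in pair_graph) ex_spanning_tree_labelling:
  assumes conn: "Digraph_Component.connected (with_proj G)"
  shows "\<exists>f. tree_labelling G c (pverts G) f"
proof -
  obtain r where r: "r \<in> pverts G"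
    using conn by (auto simp: connected_def strongly_connected_def)
  \<comment> \<open>Here \<open>k\<close> counts the leaves added to the root, so the labelled set
    has \<open>k + 1\<close> vertices.\<close>
  have "\<exists>S f. S \<subseteq> pverts G \<and> card S = Suc k \<and> tree_labelling G c S f"
    if "k < card (pverts G)" for k
    using that
  proof (induction k)
    case 0
    then show ?case
      using r tree_labelling_singleton[OF r]
      by (intro exI[of _ "{r}"] exI[of _ "\<lambda>_. {}"]) simp
  next
    case (Suc k)
    then obtain S f where S: "S \<subseteq> pverts G" "card S = Suc k" "tree_labelling G c S f"
      by auto
    then have "S \<subset> pverts G" "S \<noteq> {}"
      using Suc.prems by auto
    with crossing_arc[OF conn] obtain u x where x: "u \<in> S" "x \<notin> S" "(u, x) \<in> parcs G"
      by blast
    have "finite S"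
      using S(2) card.infinite by fastforce
    then have "insert x S \<subseteq> pverts G" "card (insert x S) = Suc (Suc k)"
      using S x by (auto simp: in_arcsD2)
    then show ?case
      using tree_labelling_insert[OF S(3) x] by blast
  qed
  \<comment> \<open>The root \<open>r\<close> shows that the vertex set is nonempty, so the
    subtraction is not truncated and the labelled set has full size.\<close>
  from this[of "card (pverts G) - 1"] r obtain S f
    where S: "S \<subseteq> pverts G" "card S = card (pverts G)" "tree_labelling G c S f"
    by (metis Suc_pred' card_gt_0_iff diff_less empty_iff finite_verts pair_finite_verts zero_less_one)
  then have "S = pverts G"
    by (simp add: card_subset_eq)
  with S show ?thesis
    by blast
qed

theorem corollary2p4:
  fixes G :: "'a pair_pre_digraph"
  assumes "pair_graph G"
    and "Digraph_Component.connected (with_proj G)"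
  shows "int (parity_number G) \<ge> \<lceil>log 2 (real (card (pverts G)))\<rceil>"
proof -
  interpret pair_graph G by fact
  have "\<exists>k. \<exists>c :: 'a set \<Rightarrow> nat. parity_edge_coloring G c \<and> card (c ` edges G) = k"
    using ex_parity_edge_coloring[OF assms(1)] by blast
  \<comment> \<open>The least number of colors is attained, so an optimal coloring can be
    fixed.\<close>
  from LeastI_ex[OF this]
  obtain c :: "'a set \<Rightarrow> nat" where c: "parity_edge_coloring G c"
    and card_c: "card (c ` edges G) = parity_number G"
    unfolding parity_number_def by blast
  obtain f where f: "tree_labelling G c (pverts G) f"
    using ex_spanning_tree_labelling[OF assms(2)] by blast
  have fin: "finite (c ` edges G)"
    by (simp add: edges_def)
  \<comment> \<open>The labels inject the vertices into the subsets of the set of used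
    colors.\<close>
  have "card (pverts G) \<le> card (Pow (c ` edges G))"
    using tree_labelling_inj_on[OF c f] f fin
    by (intro card_inj_on_le[of f]) (auto simp: tree_labelling_def)
  then have "card (pverts G) \<le> 2 ^ parity_number G"
    using fin by (simp add: card_Pow card_c)
  \<comment> \<open>Connectedness includes having a vertex, so the logarithm is taken of a positive
    number.\<close>
  moreover have "card (pverts G) > 0"
    using assms(2) by (auto simp: connected_def strongly_connected_def card_gt_0_iff)
  ultimately have "log 2 (real (card (pverts G))) \<le> real (parity_number G)"
    by (intro log2_of_power_le)
  then show ?thesis
    by (simp add: ceiling_le_iff)
qed

end
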